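(* Let $n\ge 3$. Then $\mathcal P_n$ is a simplicial complex on the vertex set $[3,n]$, and it has dimension $\lfloor\frac{n-1}{2}\rfloor-1$.
   Context: $[m,n]=\{m,m+1,\dots,n\}$, $[n]=[1,n]$, and $\mathfrak S_n$ is the set of permutations of $[n]$ in one-line notation. The circular peak set of $\sigma\in\mathfrak S_n$ is $CP(\sigma)=\{\sigma(i)\mid 2\le i\le n-1,\ \sigma(i-1)<\sigma(i)>\sigma(i+1)\}$; for $S\subseteq[n]$, $CP_n(S)=\{\sigma\in\mathfrak S_n\mid CP(\sigma)=S\}$, and $\mathcal P_n=\{S\subseteq[n]\mid CP_n(S)\neq\emptyset\}$, ordered by inclusion. A simplicial complex $\Delta$ on a vertex set $V$ is a collection of subsets of $V$ such that $\{x\}\in\Delta$ for every $x\in V$ and $T\in\Delta$ whenever $T\subseteq S\in\Delta$. The dimension of a face $S$ is $|S|-1$ (so $\emptyset$ has dimension $-1$), and the dimension of the complex is the maximum dimension of its faces. *)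

theory Defs
  imports Complex_Main "HOL-Combinatorics.Permutations"
begin

text \<open>A permutation of \<open>[n] = {1..n}\<close> is a function \<open>\<sigma>\<close> with \<open>\<sigma> permutes {1..n}\<close>; its one-line
  notation is \<open>\<sigma> 1 \<dots> \<sigma> n\<close>. Peaks are recorded by value, not by position.\<close>

definition circular_peak_set :: "nat \<Rightarrow> (nat \<Rightarrow> nat) \<Rightarrow> nat set" where
  "circular_peak_set n \<sigma> =
     {\<sigma> i | i. 2 \<le> i \<and> i \<le> n - 1 \<and> \<sigma> (i - 1) < \<sigma> i \<and> \<sigma> i > \<sigma> (i + 1)}"

definition perms_with_peak_set :: "nat \<Rightarrow> nat set \<Rightarrow> (nat \<Rightarrow> nat) set" where
  "perms_with_peak_set n S = {\<sigma>. \<sigma> permutes {1..n} \<and> circular_peak_set n \<sigma> = S}"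

definition peak_complex :: "nat \<Rightarrow> nat set set" where
  "peak_complex n = {S. S \<subseteq> {1..n} \<and> perms_with_peak_set n S \<noteq> {}}"

definition simplicial_complex_on :: "'a set \<Rightarrow> 'a set set \<Rightarrow> bool" where
  "simplicial_complex_on V \<Delta> \<longleftrightarrow>
     \<Delta> \<subseteq> Pow V \<and> (\<forall>x\<in>V. {x} \<in> \<Delta>) \<and> (\<forall>S T. S \<in> \<Delta> \<and> T \<subseteq> S \<longrightarrow> T \<in> \<Delta>)"

text \<open>Dimensions are integers, so that the empty face has dimension \<open>-1\<close>.\<close>

definition face_dim :: "'a set \<Rightarrow> int" where
  "face_dim S = int (card S) - 1"

text \<open>Only meaningful for a nonempty finite collection of finite faces, as \<open>Max\<close> and \<open>card\<close> require.\<close>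

definition complex_dim :: "'a set set \<Rightarrow> int" where
  "complex_dim \<Delta> = Max (face_dim ` \<Delta>)"

end

theory Submission
  imports Defs "HOL-Library.Infinite_Set"
begin

text \<open>A set \<open>S \<subseteq> [n]\<close> is a circular peak set iff every \<open>s \<in> S\<close> exceeds twice the number of elements of
  \<open>S\<close> up to \<open>s\<close>. Necessity: the neighbours of the \<open>j\<close> peaks of height at most \<open>s\<close> contain at least
  \<open>j + 1\<close> values that are below \<open>s\<close> and are not peaks. Sufficiency: list the peaks as
  \<open>s\<^sub>1 < \<dots> < s\<^sub>k\<close> and the remaining values as \<open>t\<^sub>1 < t\<^sub>2 < \<dots>\<close>; the condition says
  \<open>t\<^sub>i\<^sub>+\<^sub>1 < s\<^sub>i\<close>, so \<open>t\<^sub>1 s\<^sub>1 t\<^sub>2 s\<^sub>2 \<dots> t\<^sub>k s\<^sub>k t\<^sub>k\<^sub>+\<^sub>1 t\<^sub>k\<^sub>+\<^sub>2 \<dots>\<close> has exactly these peaks. The criterion is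
  clearly inherited by subsets, and the largest sets it admits have the size of
  \<open>{3, 5, 7, \<dots>} \<inter> [n]\<close>.\<close>

section \<open>Ballot sets and their maximal size\<close>

definition ballot_set :: "nat set \<Rightarrow> bool" where
  "ballot_set S \<longleftrightarrow> (\<forall>s\<in>S. 2 * card (S \<inter> {..s}) < s)"

lemma ballot_set_subset:
  assumes "ballot_set S" "T \<subseteq> S"
  shows "ballot_set T"
proof -
  have "card (T \<inter> {..s}) \<le> card (S \<inter> {..s})" for s
    using assms(2) by (intro card_mono) auto
  then show ?thesis
    using assms unfolding ballot_set_def by (meson le_less_trans mult_le_mono2 subsetD)
qed

lemma ballot_set_singleton: "ballot_set {x} \<longleftrightarrow> 3 \<le> x"
  by (auto simp: ballot_set_def)

text \<open>Test the condition at \<open>Max S\<close>, where the count is all of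
  \<open>card S\<close>; \<open>0 < n\<close> settles the empty set.\<close>

lemma ballot_set_card:
  assumes "ballot_set S" "S \<subseteq> {1..n}" "0 < n"
  shows "2 * card S < n"
proof (cases "S = {}")
  case False
  have "finite S"
    using assms(2) finite_subset by blast
  then have "S \<inter> {..Max S} = S" "Max S \<in> S"
    using False by auto
  then have "2 * card S < Max S" "Max S \<le> n"
    using assms by (force simp: ballot_set_def)+
  then show ?thesis by simp
qed (use assms in simp)

text \<open>At most \<open>i\<close> elements lie up to \<open>2 * i + 1\<close>, which is just
  enough. With \<open>k = (n - 1) div 2\<close> this attains the bound of
  \<open>ballot_set_card\<close>.\<close>

lemma ballot_set_odds: "ballot_set ((\<lambda>i. 2 * i + 1) ` {1..k})"
  unfolding ballot_set_def
proof
  fix s assume "s \<in> (\<lambda>i. 2 * i + 1) ` {1..k}"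
  then obtain i where i: "s = 2 * i + 1" by auto
  have "card ((\<lambda>i. 2 * i + 1) ` {1..k} \<inter> {..s}) \<le> card ((\<lambda>i. 2 * i + 1) ` {1..i})"
    using i by (intro card_mono) auto
  also have "\<dots> \<le> card {1..i}" by (rule card_image_le) simp
  finally show "2 * card ((\<lambda>i. 2 * i + 1) ` {1..k} \<inter> {..s}) < s"
    using i by simp
qed

section \<open>Necessity: counting the neighbours of low peaks\<close>

lemma ballot_set_circular_peak_set:
  assumes \<sigma>: "\<sigma> permutes {1..n}"
  shows "ballot_set (circular_peak_set n \<sigma>)"
  unfolding ballot_set_def
proof
  fix s assume s: "s \<in> circular_peak_set n \<sigma>"
  \<comment> \<open>Counting is done on positions: \<open>P\<close> holds the peaks of height at
    most \<open>s\<close>, \<open>N\<close> all their left neighbours together with the right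
    neighbour of the last one. That extra position makes the final inequality strict.\<close>
  define P where "P = {i. 2 \<le> i \<and> i \<le> n - 1 \<and> \<sigma> (i - 1) < \<sigma> i \<and> \<sigma> (i + 1) < \<sigma> i \<and> \<sigma> i \<le> s}"
  define N where "N = (\<lambda>i. i - 1) ` P \<union> {Max P + 1}"
  have inj: "inj_on \<sigma> A" for A
    using permutes_inj[OF \<sigma>] inj_on_subset by blast
  have peaks: "circular_peak_set n \<sigma> \<inter> {..s} = \<sigma> ` P"
    by (auto simp: circular_peak_set_def P_def)
  have fin: "finite P"
    by (rule finite_subset[of _ "{..n}"]) (auto simp: P_def)
  have "P \<noteq> {}"
    using s peaks by auto
  then have maxP: "Max P \<in> P" and le: "\<And>i. i \<in> P \<Longrightarrow> i \<le> Max P"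
    using fin by auto
  have "card ((\<lambda>i. i - 1) ` P) = card P"
    by (rule card_image) (force simp: P_def inj_on_def)
  moreover have "Max P + 1 \<notin> (\<lambda>i. i - 1) ` P"
    using le by force
  ultimately have cN: "card N = card P + 1"
    using fin by (simp add: N_def)
  \<comment> \<open>Two adjacent positions cannot both be peaks, so no left neighbour lies in
    \<open>P\<close>; \<open>Max P + 1\<close> avoids \<open>P\<close> by maximality.\<close>
  have N1: "i \<in> {1..n} \<and> \<sigma> i < s \<and> i \<notin> P" if "i \<in> N" for i
  proof -
    consider "i + 1 \<in> P" "1 \<le> i" | "i = Max P + 1"
      using \<open>i \<in> N\<close> by (force simp: N_def P_def)
    then show ?thesis
    proof cases
      case 1
      then show ?thesis by (auto simp: P_def)
    next
      case 2
      then have "i \<notin> P"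
        using le[of i] by auto
      moreover have "j + 1 \<in> {1..n} \<and> \<sigma> (j + 1) < s" if "j \<in> P" for j
        using that by (auto simp: P_def)
      then have "Max P + 1 \<in> {1..n} \<and> \<sigma> (Max P + 1) < s"
        using maxP by blast
      ultimately show ?thesis using 2 by simp
    qed
  qed
  have "finite N"
    using fin by (simp add: N_def)
  \<comment> \<open>By injectivity these are \<open>2 * card P + 1\<close> distinct values, all in
    \<open>{1..s}\<close>.\<close>
  have "\<sigma> ` (P \<union> N) \<subseteq> {1..s}"
  proof
    fix v assume "v \<in> \<sigma> ` (P \<union> N)"
    then obtain i where i: "v = \<sigma> i" "i \<in> P \<union> N" by auto
    have "i \<in> {1..n}" "\<sigma> i \<le> s"
      using i N1[of i] by (auto simp: P_def)
    then show "v \<in> {1..s}"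
      using permutes_in_image[OF \<sigma>, of i] i by simp
  qed
  then have "card (\<sigma> ` (P \<union> N)) \<le> s"
    using card_mono[of "{1..s}" "\<sigma> ` (P \<union> N)"] by simp
  moreover have "card (P \<union> N) = card P + card N"
    using fin \<open>finite N\<close> N1 by (intro card_Un_disjoint) auto
  ultimately show "2 * card (circular_peak_set n \<sigma> \<inter> {..s}) < s"
    using cN by (simp add: peaks card_image[OF inj])
qed

section \<open>Sufficiency: an alternating arrangement\<close>

lemma ballot_set_imp_peak_set:
  assumes S: "ballot_set S" "S \<subseteq> {1..n}" and n: "0 < n"
  obtains \<sigma> where "\<sigma> permutes {1..n}" "circular_peak_set n \<sigma> = S"
proof -
  define k where "k = card S"
  have fS: "finite S"
    using S(2) finite_subset by blast
  have k: "2 * k < n"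
    using ballot_set_card[OF S n] by (simp add: k_def)
  have cT: "card ({1..n} - S) = n - k"
    using S(2) fS by (simp add: card_Diff_subset k_def)
  obtain s where s: "strict_mono_on {..<k} s" "s ` {..<k} = S"
    using ex_bij_betw_strict_mono_card[OF fS] unfolding k_def bij_betw_def by blast
  obtain t where t: "strict_mono_on {..<n - k} t" "t ` {..<n - k} = {1..n} - S"
    using ex_bij_betw_strict_mono_card[of "{1..n} - S"] unfolding cT bij_betw_def by blast
  have s_in: "s j \<in> S" if "j < k" for j
    using s(2) that by blast
  have t_in: "t j \<in> {1..n} - S" if "j < n - k" for j
    using t(2) that by blast
  have t_less: "t i < t j" if "i < j" "j < n - k" for i j
    using strict_mono_onD[OF t(1), of i j] that by simp
  have s_le: "s i \<le> s j" if "i \<le> j" "j < k" for i j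
    using strict_mono_on_leD[OF s(1), of i j] that by simp
  have s_eq: "s i = s j \<longleftrightarrow> i = j" if "i < k" "j < k" for i j
    using strict_mono_on_imp_inj_on[OF s(1)] that by (auto dest: inj_onD)
  have t_neq_s: "t j \<noteq> s i" if "i < k" "j < n - k" for i j
    using s_in[OF that(1)] t_in[OF that(2)] by auto

  \<comment> \<open>Indices start at 0, so the ballot condition forces \<open>s j\<close> above
    \<open>2 * Suc j\<close>. If \<open>t (Suc j)\<close> were not below \<open>s j\<close>, then
    \<open>{1..s j}\<close> would be covered by the first \<open>Suc j\<close> peaks and the first
    \<open>Suc j\<close> non-peaks, which are too few.\<close>
  have t_Suc_less: "t (Suc j) < s j" if j: "j < k" for j
  proof (rule ccontr)
    assume neg: "\<not> t (Suc j) < s j"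
    have "s ` {..j} \<subseteq> S \<inter> {..s j}"
      using j s_in s_le by auto
    moreover have "card (s ` {..j}) = Suc j"
      using j s_eq by (subst card_image) (auto simp: inj_on_def)
    ultimately have "Suc j \<le> card (S \<inter> {..s j})"
      using card_mono[of "S \<inter> {..s j}" "s ` {..j}"] fS by simp
    moreover have "2 * card (S \<inter> {..s j}) < s j"
      using S(1) s_in[OF j] unfolding ballot_set_def by blast
    ultimately have large: "2 * Suc j < s j"
      by (meson le_less_trans mult_le_mono2)
    have "{1..s j} \<subseteq> s ` {..j} \<union> t ` {..j}"
    proof
      fix v assume v: "v \<in> {1..s j}"
      moreover have "s j \<le> n"
        using s_in[OF j] S(2) by auto
      ultimately have "v \<in> {1..n}" by simp
      then consider "v \<in> S" | "v \<in> {1..n} - S" by blast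
      then show "v \<in> s ` {..j} \<union> t ` {..j}"
      proof cases
        case 1
        then obtain i where i: "v = s i" "i < k" using s(2) by auto
        then have "i \<le> j"
          using strict_mono_onD[OF s(1), of j i] v j by (cases "i \<le> j") auto
        then show ?thesis using i by auto
      next
        case 2
        then have "v \<in> t ` {..<n - k}" using t(2) by simp
        then obtain i where i: "v = t i" "i < n - k" by auto
        \<comment> \<open>This makes \<open>v \<le> s j \<le> t (Suc j)\<close> strict and so rules
          out \<open>i = Suc j\<close>.\<close>
        have "v \<noteq> s j"
          using i t_neq_s[OF j] by auto
        then have "t i < t (Suc j)"
          using i v neg by auto
        then have "i \<le> j"
          using t_less[of "Suc j" i] i by (cases i "Suc j" rule: linorder_cases) auto
        then show ?thesis using i by auto
      qed
    qed
    then have "card {1..s j} \<le> card (s ` {..j} \<union> t ` {..j})"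
      by (intro card_mono) auto
    also have "\<dots> \<le> card (s ` {..j}) + card (t ` {..j})"
      by (rule card_Un_le)
    also have "\<dots> \<le> Suc j + Suc j"
      using card_image_le[of "{..j}" s] card_image_le[of "{..j}" t] by simp
    finally show False using large by simp
  qed

  \<comment> \<open>Positions up to \<open>2 * k\<close> alternate
    \<open>t 0, s 0, t 1, s 1, ...\<close>; from \<open>2 * k + 1\<close> on, the remaining
    \<open>t\<close> follow in increasing order, starting with \<open>t k\<close>. Outside
    \<open>{1..n}\<close> the identity is needed for \<open>permutes\<close>.\<close>
  define \<sigma> where "\<sigma> i =
    (if i \<notin> {1..n} then i
     else if 2 * k < i then t (i - k - 1)
     else if even i then s (i div 2 - 1)
     else t (i div 2))" for i
  have \<sigma>_even: "\<sigma> (2 * j + 2) = s j" if "j < k" for j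
    using that k by (simp add: \<sigma>_def)
  \<comment> \<open>The case \<open>j = k\<close> belongs to the tail but fits the odd pattern, so
    the last peak has a right neighbour of the same form as the others.\<close>
  have \<sigma>_odd: "\<sigma> (2 * j + 1) = t j" if "j \<le> k" for j
    using that k by (cases "j = k") (auto simp: \<sigma>_def)
  have \<sigma>_tail: "\<sigma> (k + j + 1) = t j" if "k \<le> j" "j < n - k" for j
    using that k by (auto simp: \<sigma>_def)
  have pos: "(\<exists>j<k. i = 2 * j + 2) \<or> (\<exists>j<k. i = 2 * j + 1) \<or> (\<exists>j. k \<le> j \<and> j < n - k \<and> i = k + j + 1)"
    if "i \<in> {1..n}" for i
  proof (cases "2 * k < i")
    case True
    then have "i = k + (i - k - 1) + 1" "k \<le> i - k - 1" "i - k - 1 < n - k"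
      using that by auto
    then show ?thesis by blast
  next
    case False
    then have "1 \<le> i" "i \<le> 2 * k"
      using that by auto
    then have "i = 2 * (i div 2 - 1) + 2 \<and> i div 2 - 1 < k \<or> i = 2 * (i div 2) + 1 \<and> i div 2 < k"
      by presburger
    then show ?thesis by blast
  qed
  \<comment> \<open>On a finite set surjectivity suffices: equal cardinalities then give
    injectivity.\<close>
  have "{1..n} \<subseteq> \<sigma> ` {1..n}"
  proof
    fix v assume "v \<in> {1..n}"
    then consider j where "j < k" "v = s j" | j where "j < n - k" "v = t j"
      using s(2) t(2) by blast
    then show "v \<in> \<sigma> ` {1..n}"
    proof cases
      case (1 j)
      then show ?thesis
        using \<sigma>_even[of j] k by (intro image_eqI[of _ _ "2 * j + 2"]) auto
    next
      case (2 j)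
      then show ?thesis
        using \<sigma>_odd[of j] \<sigma>_tail[of j] k
        by (intro image_eqI[of _ _ "if j \<le> k then 2 * j + 1 else k + j + 1"]) auto
    qed
  qed
  then have onto: "\<sigma> ` {1..n} = {1..n}"
    using card_image_le[of "{1..n}" \<sigma>] by (metis card_seteq finite_atLeastAtMost finite_imageI)
  then have "inj_on \<sigma> {1..n}"
    by (simp add: eq_card_imp_inj_on)
  with onto have perm: "\<sigma> permutes {1..n}"
    by (intro bij_imp_permutes) (auto simp: bij_betw_def \<sigma>_def)

  have "circular_peak_set n \<sigma> = S"
  proof (intro equalityI subsetI)
    fix v assume "v \<in> circular_peak_set n \<sigma>"
    then obtain i where i: "v = \<sigma> i" "2 \<le> i" "i \<le> n - 1" "\<sigma> (i + 1) < \<sigma> i"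
      by (auto simp: circular_peak_set_def)
    from i(2,3) have "i \<in> {1..n}" by auto
    from pos[OF this] consider j where "j < k" "i = 2 * j + 2" | j where "j < k" "i = 2 * j + 1"
      | j where "k \<le> j" "j < n - k" "i = k + j + 1"
      by blast
    then show "v \<in> S"
    proof cases
      case (1 j)
      then show ?thesis using i \<sigma>_even s_in by simp
    next
      case (2 j)
      \<comment> \<open>Here \<open>t j < t (Suc j) < s j\<close>, so the right neighbour is larger
        and there is no peak.\<close>
      then have "\<sigma> i = t j" "\<sigma> (i + 1) = s j"
        using \<sigma>_odd[of j] \<sigma>_even[of j] by auto
      moreover have "t j < t (Suc j)"
        using 2 k by (intro t_less) auto
      ultimately show ?thesis using i t_Suc_less[of j] 2 by simp
    next
      case (3 j)
      \<comment> \<open>The bound \<open>i \<le> n - 1\<close> keeps the next tail index in range;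
        the tail increases, hence has no peak.\<close>
      then have "Suc j < n - k"
        using i k by auto
      then have "\<sigma> i = t j" "\<sigma> (i + 1) = t (Suc j)" "t j < t (Suc j)"
        using 3 \<sigma>_tail[of j] \<sigma>_tail[of "Suc j"] t_less[of j "Suc j"] by auto
      then show ?thesis using i by simp
    qed
  next
    fix v assume "v \<in> S"
    then obtain j where j: "j < k" "v = s j" using s(2) by auto
    have "t j < t (Suc j)"
      using j k by (intro t_less) auto
    moreover have "\<sigma> (2 * j + 1) = t j" "\<sigma> (2 * j + 2) = s j" "\<sigma> (2 * j + 3) = t (Suc j)"
      using j \<sigma>_odd[of j] \<sigma>_even[of j] \<sigma>_odd[of "Suc j"] by (auto simp: eval_nat_numeral)
    ultimately have "\<sigma> (2 * j + 2 - 1) < \<sigma> (2 * j + 2) \<and> \<sigma> (2 * j + 2 + 1) < \<sigma> (2 * j + 2)"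
      using t_Suc_less[of j] j by (simp add: eval_nat_numeral)
    moreover have "2 \<le> 2 * j + 2" "2 * j + 2 \<le> n - 1"
      using j k by auto
    moreover have "v = \<sigma> (2 * j + 2)"
      using j \<sigma>_even by simp
    ultimately show "v \<in> circular_peak_set n \<sigma>"
      unfolding circular_peak_set_def by blast
  qed
  with perm show thesis by (rule that)
qed

section \<open>The peak complex, its vertices and its dimension\<close>

lemma peak_complex_eq:
  assumes "0 < n"
  shows "peak_complex n = {S. S \<subseteq> {1..n} \<and> ballot_set S}"
proof (intro equalityI subsetI)
  fix S assume "S \<in> peak_complex n"
  then show "S \<in> {S. S \<subseteq> {1..n} \<and> ballot_set S}"
    using ballot_set_circular_peak_set by (auto simp: peak_complex_def perms_with_peak_set_def)
next
  fix S assume "S \<in> {S. S \<subseteq> {1..n} \<and> ballot_set S}"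
  then show "S \<in> peak_complex n"
    using ballot_set_imp_peak_set[of S n] assms
    by (auto simp: peak_complex_def perms_with_peak_set_def)
qed

theorem theorem3p1:
  fixes n :: nat
  assumes "n \<ge> 3"
  shows "simplicial_complex_on {3..n} (peak_complex n) \<and>
         complex_dim (peak_complex n) = \<lfloor>(real n - 1) / 2\<rfloor> - 1"
proof
  have eq: "peak_complex n = {S. S \<subseteq> {1..n} \<and> ballot_set S}"
    using assms by (intro peak_complex_eq) simp
  show "simplicial_complex_on {3..n} (peak_complex n)"
    unfolding simplicial_complex_on_def
  proof (intro conjI ballI allI impI)
    show "peak_complex n \<subseteq> Pow {3..n}"
    proof (intro subsetI PowI)
      \<comment> \<open>Heredity reduces the vertex bound to singletons.\<close>
      fix S x assume "S \<in> peak_complex n" "x \<in> S"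
      then have "x \<le> n" "ballot_set {x}"
        by (auto simp: eq intro: ballot_set_subset)
      then show "x \<in> {3..n}"
        by (simp add: ballot_set_singleton)
    qed
    show "{x} \<in> peak_complex n" if "x \<in> {3..n}" for x
      using that by (auto simp: eq ballot_set_singleton)
    show "T \<in> peak_complex n" if "S \<in> peak_complex n \<and> T \<subseteq> S" for S T
      using that by (auto simp: eq intro: ballot_set_subset)
  qed

  \<comment> \<open>\<open>m\<close> is the largest integer with \<open>2 * m < n\<close>; hence
    \<open>2 * m + 1 \<le> n\<close> and \<open>F\<close> fits into \<open>{1..n}\<close>.\<close>
  define m where "m = (n - 1) div 2"
  define F where "F = (\<lambda>i. 2 * i + 1) ` {1..m}"
  have "Max (face_dim ` peak_complex n) = int m - 1"
  proof (rule Max_eqI)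
    have "peak_complex n \<subseteq> Pow {1..n}"
      by (auto simp: eq)
    then show "finite (face_dim ` peak_complex n)"
      by (meson finite_Pow_iff finite_atLeastAtMost finite_imageI finite_subset)
    show "d \<le> int m - 1" if d: "d \<in> face_dim ` peak_complex n" for d
    proof -
      obtain S where S: "d = face_dim S" "S \<subseteq> {1..n}" "ballot_set S"
        using d by (auto simp: eq)
      then have "2 * card S < n"
        using assms by (intro ballot_set_card) auto
      then show ?thesis
        using S by (simp add: face_dim_def m_def)
    qed
    have "F \<subseteq> {1..n}"
      by (auto simp: F_def m_def)
    then have "F \<in> peak_complex n"
      using ballot_set_odds[of m] by (simp add: eq F_def)
    moreover have "card F = m"
      unfolding F_def by (subst card_image) (auto simp: inj_on_def)
    ultimately show "int m - 1 \<in> face_dim ` peak_complex n"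
      by (intro image_eqI[of _ _ F]) (auto simp: face_dim_def)
  qed
  moreover have "\<lfloor>(real n - 1) / 2\<rfloor> = int m"
  proof -
    have "\<lfloor>(real n - 1) / 2\<rfloor> = \<lfloor>real (n - 1) / real 2\<rfloor>"
      using assms by (simp add: of_nat_diff)
    also have "\<dots> = int m"
      unfolding m_def by (rule floor_divide_of_nat_eq)
    finally show ?thesis .
  qed
  ultimately show "complex_dim (peak_complex n) = \<lfloor>(real n - 1) / 2\<rfloor> - 1"
    by (simp add: complex_dim_def)
qed

end
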